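(* The function $x \mapsto \frac{1}{\sqrt{1+x^2}}$ on $\mathbb{R}\setminus\{0\}$ is the Amplitude Modulation transform of the function $f(x) = \frac{1}{x}$ on $\mathbb{R}\setminus\{0\}$.
   Context: Let $U\subseteq\mathbb{R}$ be open and let $f:U\to\mathbb{R}$ be differentiable. The Amplitude Modulation transform $\mathcal{AM}(f)$ of $f$ is the function $h:U\to[0,\infty)$ whose values at the critical points of $x\mapsto f(x)\sin(x+k)$ agree up to sign with those of $f(x)\sin(x+k)$, for all values of the phase parameter $k$. That is, for every $k\in\mathbb{R}$ and every $x\in U$ at which the derivative of $t\mapsto f(t)\sin(t+k)$ vanishes, $h(x)=|f(x)\sin(x+k)|$. Saying that a function is the transform of $f$ means that it is the unique function $h:U\to[0,\infty)$ with this property. *)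

theory Defs
  imports "HOL-Analysis.Analysis"
begin

text \<open>
  A real function on a set \<open>U\<close> is represented by a total function \<open>real \<Rightarrow> real\<close>
  of which only the values on \<open>U\<close> matter; accordingly, uniqueness below means agreement on \<open>U\<close>.
\<close>

definition AM_property :: "real set \<Rightarrow> (real \<Rightarrow> real) \<Rightarrow> (real \<Rightarrow> real) \<Rightarrow> bool" where
  "AM_property U f h \<longleftrightarrow>
     (\<forall>x\<in>U. h x \<ge> 0) \<and>
     (\<forall>k. \<forall>x\<in>U. ((\<lambda>t. f t * sin (t + k)) has_real_derivative 0) (at x) \<longrightarrow>
        h x = \<bar>f x * sin (x + k)\<bar>)"

text \<open>
  Since \<open>U\<close> is open, the two-sided derivative \<open>at x\<close> above depends only on the
  values of \<open>f\<close> on \<open>U\<close>.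
\<close>

definition is_AM_transform :: "real set \<Rightarrow> (real \<Rightarrow> real) \<Rightarrow> (real \<Rightarrow> real) \<Rightarrow> bool" where
  "is_AM_transform U f h \<longleftrightarrow>
     open U \<and> f differentiable_on U \<and>
     AM_property U f h \<and>
     (\<forall>g. AM_property U f g \<longrightarrow> (\<forall>x\<in>U. g x = h x))"

end

theory Submission imports Defs begin

text \<open>For \<open>x\<close> nonzero, the quotient rule makes \<open>x\<close> critical for
  phase \<open>k\<close> exactly when \<open>sin (x + k) = x * cos (x + k)\<close>
  (\<open>critical_point_sin_over_id_iff\<close>). The value there is then
  \<open>cos (x + k)\<close>, and the Pythagorean identity fixes its absolute value in terms of
  \<open>x\<close> alone (\<open>abs_cos_eq_of_sin_eq\<close>), so all phases for which
  \<open>x\<close> is critical prescribe the same value. Uniqueness holds because every nonzero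
  \<open>x\<close> is critical for at least one phase.\<close>

lemma critical_point_sin_over_id_iff:
  fixes x k :: real
  assumes "x \<noteq> 0"
  shows "((\<lambda>t. 1 / t * sin (t + k)) has_real_derivative 0) (at x) \<longleftrightarrow> sin (x + k) = x * cos (x + k)"
proof -
  have D: "((\<lambda>t. 1 / t * sin (t + k)) has_real_derivative
      (x * cos (x + k) - sin (x + k)) / x\<^sup>2) (at x)"
    using assms by (auto intro!: derivative_eq_intros simp: field_simps power2_eq_square)
  show ?thesis
  proof
    assume "((\<lambda>t. 1 / t * sin (t + k)) has_real_derivative 0) (at x)"
    then have "(x * cos (x + k) - sin (x + k)) / x\<^sup>2 = 0"
      using D DERIV_unique by blast
    then show "sin (x + k) = x * cos (x + k)"
      using assms by simp
  next
    assume "sin (x + k) = x * cos (x + k)"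
    then show "((\<lambda>t. 1 / t * sin (t + k)) has_real_derivative 0) (at x)"
      using D by simp
  qed
qed

text \<open>Substituting the hypothesis into \<open>sin^2 + cos^2 = 1\<close> leaves
  \<open>(1 + x^2) * cos^2 = 1\<close>; only the sign of the cosine stays undetermined.\<close>

lemma abs_cos_eq_of_sin_eq:
  fixes x y :: real
  assumes "sin y = x * cos y"
  shows "\<bar>cos y\<bar> = 1 / sqrt (1 + x\<^sup>2)"
proof -
  have "(1 + x\<^sup>2) * (cos y)\<^sup>2 = 1"
    using sin_cos_squared_add[of y] assms by (simp add: power_mult_distrib algebra_simps)
  then have "sqrt (1 + x\<^sup>2) * \<bar>cos y\<bar> = 1"
    by (metis real_sqrt_abs real_sqrt_mult real_sqrt_one)
  moreover from this have "sqrt (1 + x\<^sup>2) \<noteq> 0"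
    by (metis mult_zero_left zero_neq_one)
  ultimately show ?thesis
    by (metis eq_divide_imp mult.commute)
qed

theorem theorem1p4:
  shows "is_AM_transform (UNIV - {0 :: real}) (\<lambda>x. 1 / x) (\<lambda>x. 1 / sqrt (1 + x\<^sup>2))"
  unfolding is_AM_transform_def
proof (intro conjI allI impI ballI)
  show "open (UNIV - {0 :: real})"
    by (simp add: open_delete)
  show "(\<lambda>x::real. 1 / x) differentiable_on UNIV - {0}"
    by (auto simp: differentiable_on_def intro!: derivative_intros)
  show "AM_property (UNIV - {0 :: real}) (\<lambda>x. 1 / x) (\<lambda>x. 1 / sqrt (1 + x\<^sup>2))"
    unfolding AM_property_def
  proof (intro conjI allI impI ballI)
    fix x k :: real
    assume x: "x \<in> UNIV - {0}"
      and "((\<lambda>t. 1 / t * sin (t + k)) has_real_derivative 0) (at x)"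
    then have s: "sin (x + k) = x * cos (x + k)"
      using critical_point_sin_over_id_iff[of x k] by blast
    \<comment> \<open>The critical point equation cancels the amplitude \<open>1 / x\<close> against
      the factor \<open>x\<close>.\<close>
    have "\<bar>1 / x * sin (x + k)\<bar> = \<bar>cos (x + k)\<bar>"
      using s x by simp
    then show "1 / sqrt (1 + x\<^sup>2) = \<bar>1 / x * sin (x + k)\<bar>"
      using abs_cos_eq_of_sin_eq[OF s] by simp
  qed simp
next
  fix g :: "real \<Rightarrow> real" and x :: real
  assume g: "AM_property (UNIV - {0}) (\<lambda>x. 1 / x) g" and x: "x \<in> UNIV - {0}"
  \<comment> \<open>The critical point equation asks for \<open>tan (x + k) = x\<close>; this phase
    gives \<open>x + k = arctan x\<close>, so the property constrains \<open>g\<close> at this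
    \<open>x\<close>.\<close>
  define k where "k = arctan x - x"
  have s: "sin (x + k) = x * cos (x + k)"
    by (simp add: k_def sin_arctan cos_arctan)
  then have "((\<lambda>t. 1 / t * sin (t + k)) has_real_derivative 0) (at x)"
    using x critical_point_sin_over_id_iff[of x k] by simp
  then have "g x = \<bar>1 / x * sin (x + k)\<bar>"
    using g x unfolding AM_property_def by blast
  also have "\<dots> = \<bar>cos (x + k)\<bar>"
    using s x by simp
  finally show "g x = 1 / sqrt (1 + x\<^sup>2)"
    using abs_cos_eq_of_sin_eq[OF s] by simp
qed

end
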